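(* For every positive integer $m$, \[ \ell(m)\leq \frac{5+\sqrt{9+24m}}{2}. \]
   Context: $J$ is the graph (with loops) on three vertices $a,b,c$ whose edges are $ab$ and a loop at $b$; $c$ is an isolated unlooped vertex. For a simple graph $G$, $j(G)$ denotes the number of maps $\phi:V(G)\to V(J)$ with $\phi(x)\phi(y)\in E(J)$ whenever $xy\in E(G)$. A graph with $n$ vertices and $m$ edges is $J$-extremal if $j(G)\geq j(G')$ for every simple graph $G'$ with $n$ vertices and $m$ edges. The lexicographic order on subsets of $[q]$ is $A<B$ iff $\min(A\triangle B)\in A$; the lex graph $L(q,m)$ has vertex set $[q]$ and edge set the first $m$ two-element subsets of $[q]$ in this order. $E_r$ is the edgeless graph on $r$ vertices. For integers $n,q,m$ with $q\le\min\{n,m+1\}$ and $0\le m\le\binom q2$, $R(n,q;m)=L(q,m)\cup E_{n-q}$ (disjoint union). Then $\ell(m)=\max\{q : R(m+1,q;m)\text{ is }J\text{-extremal}\}$, the maximum over admissible $q$. *)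

theory Defs
  imports Complex_Main "HOL-Library.FuncSet" "HOL-Library.Ramsey"
begin

text \<open>A graph is a pair of a vertex set and an edge set; the edge \<open>xy\<close> is the set
  \<open>{x, y}\<close>, so that a loop at \<open>x\<close> is the singleton \<open>{x}\<close>.\<close>

type_synonym 'a graph = "'a set \<times> 'a set set"

abbreviation verts :: "'a graph \<Rightarrow> 'a set" where
  "verts G \<equiv> fst G"

abbreviation edges :: "'a graph \<Rightarrow> 'a set set" where
  "edges G \<equiv> snd G"

definition simple_graph :: "'a graph \<Rightarrow> bool" where
  "simple_graph G \<longleftrightarrow> finite (verts G) \<and> edges G \<subseteq> [verts G]\<^bsup>2\<^esup>"

definition homs :: "'a graph \<Rightarrow> 'b graph \<Rightarrow> ('a \<Rightarrow> 'b) set" where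
  "homs G H = {\<phi> \<in> verts G \<rightarrow>\<^sub>E verts H.
     \<forall>x\<in>verts G. \<forall>y\<in>verts G. {x, y} \<in> edges G \<longrightarrow> {\<phi> x, \<phi> y} \<in> edges H}"

datatype jvert = Ja | Jb | Jc

definition J_graph :: "jvert graph" where
  "J_graph = ({Ja, Jb, Jc}, {{Ja, Jb}, {Jb}})"

definition j :: "'a graph \<Rightarrow> nat" where
  "j G = card (homs G J_graph)"

text \<open>Every finite graph is isomorphic to one whose vertices are natural numbers, so
  comparing with graphs of that type loses nothing.\<close>

definition J_extremal :: "nat graph \<Rightarrow> bool" where
  "J_extremal G \<longleftrightarrow> simple_graph G \<and>
     (\<forall>G' :: nat graph. simple_graph G' \<and> card (verts G') = card (verts G) \<and>
        card (edges G') = card (edges G) \<longrightarrow> j G' \<le> j G)"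

text \<open>\<open>Min\<close> is unspecified on the empty set, hence the explicit \<open>A \<noteq> B\<close>.\<close>

definition lex_less :: "nat set \<Rightarrow> nat set \<Rightarrow> bool" where
  "lex_less A B \<longleftrightarrow> A \<noteq> B \<and> Min ((A - B) \<union> (B - A)) \<in> A"

text \<open>A pair is among the first \<open>m\<close> iff fewer than \<open>m\<close> pairs precede it.\<close>

definition lex_graph :: "nat \<Rightarrow> nat \<Rightarrow> nat graph" where
  "lex_graph q m =
     ({1..q}, {A \<in> [{1..q}]\<^bsup>2\<^esup>. card {B \<in> [{1..q}]\<^bsup>2\<^esup>. lex_less B A} < m})"

definition edgeless_on :: "'a set \<Rightarrow> 'a graph" where
  "edgeless_on S = (S, {})"

definition graph_union :: "'a graph \<Rightarrow> 'a graph \<Rightarrow> 'a graph" where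
  "graph_union G H = (verts G \<union> verts H, edges G \<union> edges H)"

definition admissible :: "nat \<Rightarrow> nat \<Rightarrow> nat \<Rightarrow> bool" where
  "admissible n q m \<longleftrightarrow> q \<le> min n (m + 1) \<and> m \<le> q choose 2"

text \<open>The edgeless graph on \<open>n - q\<close> vertices is placed on \<open>{q+1..n}\<close>, which makes the
  union with the lex graph on \<open>{1..q}\<close> disjoint.\<close>

definition R_graph :: "nat \<Rightarrow> nat \<Rightarrow> nat \<Rightarrow> nat graph" where
  "R_graph n q m = graph_union (lex_graph q m) (edgeless_on {q+1..n})"

definition ell :: "nat \<Rightarrow> nat" where
  "ell m = Max {q. admissible (m + 1) q m \<and> J_extremal (R_graph (m + 1) q m)}"

end

theory Submission
  imports Defs
begin

text \<open>An isolated vertex has three images in \<open>J\<close>, and on the remaining vertices a homomorphism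
  is given by the independent set mapped to \<open>a\<close>. So \<open>j G\<close> is \<open>3\<close> to the number of isolated
  vertices times the number of independent sets of the rest. Independent sets are cliques of the
  complement, and a graph with \<open>C(r,2) + s\<close> edges, \<open>s \<le> r\<close>, has at most as many cliques as a
  complete graph on \<open>r\<close> vertices with one more vertex joined to \<open>s\<close> of them; this follows by
  deleting a vertex of least positive degree. The complement of \<open>L(q,m)\<close> attains the bound, so
  some \<open>R(m+1,q;m)\<close> is extremal and \<open>ell m\<close> is the maximum of a nonempty set. If \<open>q\<close> exceeds
  the stated bound, then replacing \<open>q\<close> by \<open>q - 2\<close> increases the number of dominating vertices
  of the lex graph by at most one, and the factor \<open>9\<close> gained from two more isolated vertices
  outweighs the loss of at most a factor \<open>8\<close> in the main term \<open>2 ^ r\<close>.\<close>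

section \<open>The largest number of cliques for a given number of edges\<close>

definition cliques :: "'a set set \<Rightarrow> 'a set set" where
  "cliques F = {S. finite S \<and> 2 \<le> card S \<and> [S]\<^bsup>2\<^esup> \<subseteq> F}"

definition indep_sets :: "'a set \<Rightarrow> 'a set set \<Rightarrow> 'a set set" where
  "indep_sets V E = {S. S \<subseteq> V \<and> (\<forall>e\<in>E. \<not> e \<subseteq> S)}"

text \<open>With \<open>w\<close> the smallest exponent, the right side minus the left is
  \<open>2 ^ w * (2 ^ l - 1) * (2 ^ k - 1)\<close>, a product of nonnegative factors. This is what
  compares clique counts before and after the deletion of a vertex.\<close>

lemma pow2_convex:
  fixes x y z w :: nat
  assumes "x + y = z + w" "x \<le> z" "y \<le> z"
  shows "(2::nat) ^ x + 2 ^ y \<le> 2 ^ z + 2 ^ w"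
proof -
  obtain k where k: "z = x + k" "y = w + k"
    using assms by (metis add.commute add_left_imp_eq le_Suc_ex group_cancel.add1)
  obtain l where l: "x = w + l"
    using assms k by (metis add_le_cancel_right le_Suc_ex)
  have "0 \<le> 2 ^ w * ((2::int) ^ l - 1) * (2 ^ k - 1)"
    by simp
  hence "(2::int) ^ x + 2 ^ y \<le> 2 ^ z + 2 ^ w"
    by (simp add: k l power_add algebra_simps)
  hence "int (2 ^ x + 2 ^ y) \<le> int (2 ^ z + 2 ^ w)" by simp
  thus ?thesis by linarith
qed

lemma Suc_choose_two: "Suc n choose 2 = n + (n choose 2)"
  by (simp add: numeral_2_eq_2)

lemma two_choose_two: "2 * int (n choose 2) = int n * (int n - 1)"
  by (induction n) (simp_all add: Suc_choose_two algebra_simps)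

lemma card_nsets_two: "finite A \<Longrightarrow> card ([A]\<^bsup>2\<^esup>) = card A choose 2"
  using n_subsets[of A 2] by (simp add: nsets_def) (metis (no_types, lifting) Collect_cong rev_finite_subset)

lemma pair_nsetsI: "x \<in> A \<Longrightarrow> y \<in> A \<Longrightarrow> x \<noteq> y \<Longrightarrow> {x, y} \<in> [A]\<^bsup>2\<^esup>"
  by (simp add: nsets_def)

lemma finite_nsets_two: "finite A \<Longrightarrow> finite ([A]\<^bsup>2\<^esup>)"
  by (rule finite_subset[of _ "Pow A"]) (auto simp: nsets_def)

text \<open>The size condition in \<open>cliques\<close> is essential here: a second member of the
  clique supplies an edge through the first. It confines the family to a power set although no
  ambient vertex set is given.\<close>

lemma cliques_subset_Union: "S \<in> cliques F \<Longrightarrow> S \<subseteq> \<Union>F"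
proof
  fix x assume S: "S \<in> cliques F" and x: "x \<in> S"
  have "\<not> S \<subseteq> {x}" using S card_mono[of "{x}" S] by (auto simp: cliques_def)
  then obtain y where "y \<in> S" "y \<noteq> x" by auto
  hence "{x, y} \<in> F" using S x pair_nsetsI[of x S y] by (auto simp: cliques_def)
  thus "x \<in> \<Union>F" by auto
qed

lemma finite_cliques:
  assumes "finite F" "\<And>e. e \<in> F \<Longrightarrow> card e = 2"
  shows "finite (cliques F)"
proof (rule finite_subset)
  show "cliques F \<subseteq> Pow (\<Union>F)" using cliques_subset_Union by blast
  have "\<And>e. e \<in> F \<Longrightarrow> finite e" using assms(2) by (metis card.infinite zero_neq_numeral)
  thus "finite (Pow (\<Union>F))" using assms(1) by simp
qed

lemma card_star:
  assumes "\<And>e. e \<in> F \<Longrightarrow> card e = 2"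
  shows "card {e \<in> F. v \<in> e} = card {u. {v, u} \<in> F}"
proof -
  have "bij_betw (\<lambda>u. {v, u}) {u. {v, u} \<in> F} {e \<in> F. v \<in> e}"
    unfolding bij_betw_def
  proof
    show "inj_on (\<lambda>u. {v, u}) {u. {v, u} \<in> F}"
      by (auto simp: inj_on_def doubleton_eq_iff)
    show "(\<lambda>u. {v, u}) ` {u. {v, u} \<in> F} = {e \<in> F. v \<in> e}"
    proof (intro equalityI subsetI)
      fix e assume e: "e \<in> {e \<in> F. v \<in> e}"
      then obtain a b where "e = {a, b}" using assms by (metis (no_types, lifting) card_2_iff mem_Collect_eq)
      thus "e \<in> (\<lambda>u. {v, u}) ` {u. {v, u} \<in> F}"
        using e by (cases "v = a") (auto simp: insert_commute)
    qed auto
  qed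
  thus ?thesis by (simp add: bij_betw_same_card)
qed

text \<open>Let \<open>v\<close> have least degree \<open>d\<close> among the vertices on some edge.
  With its neighbours it makes \<open>d + 1\<close> vertices, so at least that many lie on edges,
  each of degree at least \<open>d\<close>. Counting edge ends gives
  \<open>(d + 1) * d \<le> 2 * card F\<close>.\<close>

lemma exists_low_degree_vertex:
  assumes F: "finite F" "F \<noteq> {}" and two: "\<And>e. e \<in> F \<Longrightarrow> card e = 2"
  obtains v where "v \<in> \<Union>F" "Suc (card {e \<in> F. v \<in> e}) choose 2 \<le> card F"
proof -
  define deg where "deg = (\<lambda>v. card {e \<in> F. v \<in> e})"
  have fin: "\<And>e. e \<in> F \<Longrightarrow> finite e" using two by (metis card.infinite zero_neq_numeral)
  have finU: "finite (\<Union>F)" using F fin by auto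
  have ne: "\<Union>F \<noteq> {}"
  proof -
    obtain e where e: "e \<in> F" using F by auto
    hence "e \<noteq> {}" using two by fastforce
    thus ?thesis using e by auto
  qed
  obtain v where v: "v \<in> \<Union>F" "\<And>u. u \<in> \<Union>F \<Longrightarrow> deg v \<le> deg u"
    using ex_min_if_finite[of "deg ` \<Union>F"] finU ne
    by (metis arg_min_if_finite(1) arg_min_least)
  let ?N = "{u. {v, u} \<in> F}"
  have "v \<notin> ?N" using two[of "{v}"] by auto
  moreover have "finite ?N" by (rule finite_subset[OF _ finU]) auto
  ultimately have "card (insert v ?N) = Suc (deg v)"
    by (simp add: deg_def card_star[OF two])
  moreover have "card (insert v ?N) \<le> card (\<Union>F)"
    using v by (intro card_mono finU) auto
  ultimately have c: "Suc (deg v) \<le> card (\<Union>F)" by simp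
  have "Suc (deg v) * deg v \<le> card (\<Union>F) * deg v" using c by (rule mult_le_mono1)
  also have "\<dots> \<le> (\<Sum>u\<in>\<Union>F. deg u)" using sum_bounded_below[of "\<Union>F" "deg v" deg] v by simp
  also have "\<dots> = 2 * card F"
    unfolding deg_def
  proof (rule sum_multicount[OF finU F(1)], safe)
    fix e assume "e \<in> F"
    hence "{i \<in> \<Union>F. i \<in> e} = e" by auto
    thus "card {i \<in> \<Union>F. i \<in> e} = 2" using two \<open>e \<in> F\<close> by simp
  qed
  finally have "Suc (deg v) choose 2 \<le> card F" by (simp add: choose_two)
  thus ?thesis using that v(1) by (simp add: deg_def)
qed

text \<open>The bound is attained by a complete graph on \<open>r\<close> vertices, with
  \<open>2 ^ r - r - 1\<close> cliques, plus a vertex joined to \<open>s\<close> of them, which adds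
  \<open>2 ^ s - 1\<close>. Cliques through the deleted vertex \<open>v\<close> correspond to
  nonempty subsets of its neighbourhood, so there are at most \<open>2 ^ d - 1\<close> of them, and
  \<open>pow2_convex\<close> absorbs this term.\<close>

theorem card_cliques_le:
  assumes "finite F" "\<And>e. e \<in> F \<Longrightarrow> card e = 2"
    and "card F = (r choose 2) + s" "s \<le> r"
  shows "card (cliques F) + r + 2 \<le> 2 ^ r + 2 ^ s"
  using assms
proof (induction "card F" arbitrary: F r s rule: less_induct)
  case less
  show ?case
  proof (cases "F = {}")
    case True
    hence "cliques F = {}" using cliques_subset_Union[of _ F] by (fastforce simp: cliques_def)
    moreover have "s = 0" "r choose 2 = 0" using less.prems True by auto
    hence "r \<le> 1" by (metis binomial_eq_0_iff less_2_cases_iff less_or_eq_imp_le nat_less_le One_nat_def less_Suc0)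
    ultimately show ?thesis using \<open>s = 0\<close> by (cases r) auto
  next
    case False
    obtain v where v: "v \<in> \<Union>F" and low: "Suc (card {e \<in> F. v \<in> e}) choose 2 \<le> card F"
      using exists_low_degree_vertex[OF less.prems(1) False less.prems(2)] by blast
    define N where "N = {u. {v, u} \<in> F}"
    define d where "d = card N"
    define F' where "F' = {e \<in> F. v \<notin> e}"
    have d: "card {e \<in> F. v \<in> e} = d"
      using card_star[OF less.prems(2)] by (simp add: d_def N_def)
    have finN: "finite N"
    proof (rule finite_subset)
      show "N \<subseteq> \<Union>F" by (auto simp: N_def)
      show "finite (\<Union>F)" using less.prems(1,2) by (metis card.infinite finite_Union zero_neq_numeral)
    qed
    have cF: "card F = card F' + d"
    proof -
      have "card (F' \<union> {e \<in> F. v \<in> e}) = card F' + d"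
        using less.prems(1) d by (subst card_Un_disjoint) (auto simp: F'_def)
      moreover have "F' \<union> {e \<in> F. v \<in> e} = F" by (auto simp: F'_def)
      ultimately show ?thesis by simp
    qed
    have "d > 0"
      using v less.prems(1) by (auto simp flip: d simp: card_gt_0_iff)
    have "cliques F \<subseteq> cliques F' \<union> insert v ` (Pow N - {{}})"
    proof
      fix S assume S: "S \<in> cliques F"
      show "S \<in> cliques F' \<union> insert v ` (Pow N - {{}})"
      proof (cases "v \<in> S")
        case True
        have "S - {v} \<subseteq> N"
          using S True pair_nsetsI[of v S] by (auto simp: cliques_def N_def)
        moreover have "S - {v} \<noteq> {}"
          using S True card_mono[of "{v}" S] by (auto simp: cliques_def)
        moreover have "S = insert v (S - {v})" using True by auto
        ultimately show ?thesis by blast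
      next
        case False
        thus ?thesis using S by (auto simp: cliques_def F'_def nsets_def)
      qed
    qed
    hence "card (cliques F) \<le> card (cliques F' \<union> insert v ` (Pow N - {{}}))"
      using less.prems(1,2) finN finite_cliques[of F'] by (intro card_mono) (auto simp: F'_def)
    also have "\<dots> \<le> card (cliques F') + card (insert v ` (Pow N - {{}}))"
      by (rule card_Un_le)
    also have "card (insert v ` (Pow N - {{}})) \<le> card (Pow N - {{}})"
      using finN by (intro card_image_le) auto
    also have "\<dots> = 2 ^ d - 1" using finN by (simp add: card_Pow d_def)
    finally have le: "card (cliques F) + 1 \<le> card (cliques F') + 2 ^ d"
      using one_le_power[of "2::nat" d] by linarith
    have IH: "card (cliques F') + r' + 2 \<le> 2 ^ r' + 2 ^ s'"
      if "card F' = (r' choose 2) + s'" "s' \<le> r'" for r' s'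
      using less.hyps[of F' r' s'] that cF \<open>d > 0\<close> less.prems(1,2) by (simp add: F'_def)
    show ?thesis
    \<comment> \<open>Removing \<open>d\<close> edges lowers \<open>s\<close> by \<open>d\<close> if
      possible. Otherwise \<open>r\<close> drops to \<open>r - 1\<close>, which releases
      \<open>r - 1\<close> edges and makes the new remainder \<open>r - 1 + s - d\<close>.\<close>
    proof (cases "d \<le> s")
      case True
      have "card F' = (r choose 2) + (s - d)" using cF less.prems(3) True by simp
      hence "card (cliques F') + r + 2 \<le> 2 ^ r + 2 ^ (s - d)"
        using IH less.prems(4) by simp
      moreover have "(2::nat) ^ (s - d) + 2 ^ d \<le> 2 ^ s + 2 ^ 0"
        using True by (intro pow2_convex) auto
      ultimately show ?thesis using le by simp
    next
      case False
      \<comment> \<open>If \<open>d \<ge> r\<close>, the degree bound forces \<open>s = r\<close>.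
        Then \<open>d > s\<close> gives \<open>d \<ge> r + 1\<close>, and the degree bound would
        require at least \<open>(r + 2) choose 2\<close> edges, while there are only
        \<open>(r + 1) choose 2\<close>.\<close>
      have "d < r"
      proof (rule ccontr)
        assume a: "\<not> d < r"
        have "Suc r choose 2 \<le> Suc d choose 2"
          using a by (intro binomial_right_mono) auto
        hence "s = r" using low d less.prems(3,4) by (simp add: Suc_choose_two)
        moreover have "Suc (Suc r) choose 2 \<le> Suc d choose 2"
          using a False \<open>s = r\<close> by (intro binomial_right_mono) auto
        ultimately show False using low d less.prems(3,4) by (simp add: Suc_choose_two)
      qed
      then obtain r' where r': "r = Suc r'" by (cases r) auto
      define s' where "s' = r' + s - d"
      have s': "s' + d = r' + s" "s' \<le> r'" using False \<open>d < r\<close> r' by (auto simp: s'_def)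
      have "card F' = (r' choose 2) + s'"
        using cF less.prems(3) s' by (simp add: r' Suc_choose_two)
      hence "card (cliques F') + r' + 2 \<le> 2 ^ r' + 2 ^ s'" using IH s' by simp
      moreover have "(2::nat) ^ s' + 2 ^ d \<le> 2 ^ r' + 2 ^ s"
        using s' \<open>d < r\<close> r' by (intro pow2_convex) auto
      ultimately show ?thesis using le by (simp add: r')
    qed
  qed
qed

section \<open>From independent sets to homomorphism counts\<close>

lemma card_indep_sets_le:
  assumes V: "finite V" and E: "E \<subseteq> [V]\<^bsup>2\<^esup>"
    and c: "card E + (r choose 2) + s = card V choose 2" and s: "s \<le> r"
  shows "card (indep_sets V E) + r + 1 \<le> card V + 2 ^ r + 2 ^ s"
proof -
  define F where "F = [V]\<^bsup>2\<^esup> - E"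
  have "finite E" using E V finite_nsets_two finite_subset by blast
  hence cF: "card F = (r choose 2) + s"
    using E V c by (simp add: F_def card_Diff_subset card_nsets_two)
  have F: "finite F" "\<And>e. e \<in> F \<Longrightarrow> card e = 2"
    using V by (auto simp: F_def finite_nsets_two) (auto simp: nsets_def)
  \<comment> \<open>Sets with at most one element are split off because \<open>cliques\<close> omits
    them; they account for the summand \<open>card V + 1\<close>.\<close>
  have "indep_sets V E \<subseteq> insert {} ((\<lambda>x. {x}) ` V) \<union> cliques F"
  proof
    fix S assume S: "S \<in> indep_sets V E"
    hence fin: "finite S" using V finite_subset by (auto simp: indep_sets_def)
    consider "card S = 0" | "card S = 1" | "card S \<ge> 2" by linarith
    thus "S \<in> insert {} ((\<lambda>x. {x}) ` V) \<union> cliques F"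
    proof cases
      case 1 thus ?thesis using fin by simp
    next
      case 2 thus ?thesis using S by (auto simp: indep_sets_def card_1_singleton_iff)
    next
      case 3 thus ?thesis using S fin by (auto simp: indep_sets_def cliques_def F_def nsets_def)
    qed
  qed
  hence "card (indep_sets V E) \<le> card (insert {} ((\<lambda>x. {x}) ` V) \<union> cliques F)"
    using V F finite_cliques[of F] by (intro card_mono) auto
  also have "\<dots> \<le> card (insert {} ((\<lambda>x. {x}) ` V)) + card (cliques F)"
    by (rule card_Un_le)
  also have "card (insert {} ((\<lambda>x. {x}) ` V)) = Suc (card V)"
    using V by (subst card_insert_disjoint) (auto simp: card_image)
  finally show ?thesis using card_cliques_le[OF F cF s] by simp
qed

text \<open>No edge of the target meets \<open>Jc\<close>, so only isolated vertices can go there,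
  and these choose freely among three images. Every other vertex goes to \<open>Ja\<close> or
  \<open>Jb\<close>, and the only image forbidden to an edge is both ends at \<open>Ja\<close>;
  hence the preimage of \<open>Ja\<close> is an arbitrary independent set.\<close>

lemma j_eq:
  assumes G: "simple_graph G"
  shows "j G = 3 ^ (card (verts G) - card (\<Union>(edges G))) * card (indep_sets (\<Union>(edges G)) (edges G))"
proof -
  define V E where "V = verts G" and "E = edges G"
  define N where "N = \<Union>E"
  have V: "finite V" and E: "E \<subseteq> [V]\<^bsup>2\<^esup>" using G by (auto simp: simple_graph_def V_def E_def)
  have NV: "N \<subseteq> V" using E by (auto simp: N_def nsets_def)
  have EE: "\<exists>x y. x \<noteq> y \<and> x \<in> N \<and> y \<in> N \<and> e = {x, y}" if "e \<in> E" for e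
  proof -
    have "card e = 2" using that E by (auto simp: nsets_def)
    then obtain x y where "e = {x, y}" "x \<noteq> y" by (auto simp: card_2_iff)
    moreover have "e \<subseteq> N" using that by (auto simp: N_def)
    ultimately have "x \<noteq> y \<and> x \<in> N \<and> y \<in> N \<and> e = {x, y}" by simp
    thus ?thesis by blast
  qed
  have univ: "(UNIV :: jvert set) = {Ja, Jb, Jc}" using jvert.exhaust by blast
  have Jedge: "{a, b} \<in> edges J_graph \<longleftrightarrow> a \<noteq> Jc \<and> b \<noteq> Jc \<and> \<not> (a = Ja \<and> b = Ja)" for a b
    by (cases a; cases b) (auto simp: J_graph_def doubleton_eq_iff)
  \<comment> \<open>\<open>f\<close> separates the values on isolated vertices from the set mapped
    to \<open>Ja\<close>; its inverse \<open>g\<close> sends the remaining non-isolated vertices to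
    \<open>Jb\<close>. The restriction is \<open>undefined\<close> off \<open>V - N\<close>, as the
    extensional function space demands.\<close>
  define f where "f = (\<lambda>\<phi> :: 'a \<Rightarrow> jvert. (restrict \<phi> (V - N), {x \<in> N. \<phi> x = Ja}))"
  define g where "g = (\<lambda>(\<psi>, S). \<lambda>x. if x \<in> N then if x \<in> S then Ja else Jb else \<psi> x)"
  have notJc: "\<phi> x \<noteq> Jc" if "\<phi> \<in> homs G J_graph" "x \<in> N" for \<phi> x
  proof -
    obtain e where e: "e \<in> E" "x \<in> e" using \<open>x \<in> N\<close> by (auto simp: N_def)
    then obtain y where y: "e = {x, y}" "y \<in> N" using EE[of e] by auto
    hence "{\<phi> x, \<phi> y} \<in> edges J_graph"
      using that e NV by (auto simp: homs_def V_def E_def)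
    thus ?thesis by (simp add: Jedge)
  qed
  have "bij_betw f (homs G J_graph) ((V - N \<rightarrow>\<^sub>E UNIV) \<times> indep_sets N E)"
  proof (rule bij_betw_byWitness[where f' = g])
    show "\<forall>\<phi>\<in>homs G J_graph. g (f \<phi>) = \<phi>"
    proof (intro ballI ext)
      fix \<phi> x assume \<phi>: "\<phi> \<in> homs G J_graph"
      show "g (f \<phi>) x = \<phi> x"
      proof (cases "x \<in> N")
        case True
        thus ?thesis using notJc[OF \<phi> True] by (cases "\<phi> x") (auto simp: f_def g_def)
      next
        case False
        thus ?thesis using \<phi> by (auto simp: f_def g_def homs_def V_def)
      qed
    qed
    show "\<forall>p\<in>(V - N \<rightarrow>\<^sub>E UNIV) \<times> indep_sets N E. f (g p) = p"
    proof safe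
      fix \<psi> S assume \<psi>: "\<psi> \<in> V - N \<rightarrow>\<^sub>E (UNIV :: jvert set)" and S: "S \<in> indep_sets N E"
      have "restrict (g (\<psi>, S)) (V - N) x = \<psi> x" for x
        using PiE_arb[OF \<psi>, of x] by (simp add: g_def restrict_def)
      moreover have "{x \<in> N. g (\<psi>, S) x = Ja} = S"
        using S by (auto simp: g_def indep_sets_def)
      ultimately show "f (g (\<psi>, S)) = (\<psi>, S)" by (simp add: f_def fun_eq_iff)
    qed
    show "f ` homs G J_graph \<subseteq> (V - N \<rightarrow>\<^sub>E UNIV) \<times> indep_sets N E"
    proof -
      have "\<not> e \<subseteq> {x \<in> N. \<phi> x = Ja}" if \<phi>: "\<phi> \<in> homs G J_graph" and e: "e \<in> E" for \<phi> e
      proof -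
        obtain x y where xy: "x \<in> N" "y \<in> N" "e = {x, y}" using EE[OF e] by blast
        hence "{\<phi> x, \<phi> y} \<in> edges J_graph"
          using \<phi> e NV by (auto simp: homs_def V_def E_def)
        thus ?thesis using xy by (auto simp: Jedge)
      qed
      thus ?thesis by (auto simp: f_def indep_sets_def split: if_splits)
    qed
    show "g ` ((V - N \<rightarrow>\<^sub>E UNIV) \<times> indep_sets N E) \<subseteq> homs G J_graph"
    proof safe
      fix \<psi> S assume \<psi>: "\<psi> \<in> V - N \<rightarrow>\<^sub>E (UNIV :: jvert set)" and S: "S \<in> indep_sets N E"
      have "g (\<psi>, S) \<in> V \<rightarrow>\<^sub>E UNIV"
        using \<psi> NV by (auto simp: g_def PiE_def extensional_def)
      moreover have "{g (\<psi>, S) x, g (\<psi>, S) y} \<in> edges J_graph" if "{x, y} \<in> E" for x y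
        using that S by (auto simp: Jedge g_def indep_sets_def N_def)
      ultimately show "g (\<psi>, S) \<in> homs G J_graph"
        using univ by (auto simp: homs_def V_def E_def J_graph_def)
    qed
  qed
  hence "j G = card ((V - N \<rightarrow>\<^sub>E (UNIV :: jvert set)) \<times> indep_sets N E)"
    unfolding j_def by (rule bij_betw_same_card)
  also have "\<dots> = card (V - N \<rightarrow>\<^sub>E (UNIV :: jvert set)) * card (indep_sets N E)"
    by (rule card_cartesian_product)
  also have "card (V - N \<rightarrow>\<^sub>E (UNIV :: jvert set)) = 3 ^ card (V - N)"
    using V by (simp add: card_PiE univ numeral_3_eq_3)
  also have "card (V - N) = card V - card N"
    using NV V by (meson card_Diff_subset finite_subset)
  finally show ?thesis by (simp add: V_def E_def N_def)
qed

theorem j_le: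
  assumes G: "simple_graph G"
    and "card (edges G) + (r choose 2) + s = card (\<Union>(edges G)) choose 2" "s \<le> r"
  shows "j G \<le> 3 ^ (card (verts G) - card (\<Union>(edges G))) * (card (\<Union>(edges G)) + 2 ^ r + 2 ^ s - (r + 1))"
proof -
  have "\<Union>(edges G) \<subseteq> verts G" "edges G \<subseteq> [\<Union>(edges G)]\<^bsup>2\<^esup>"
    using G by (auto simp: simple_graph_def nsets_def)
  hence "card (indep_sets (\<Union>(edges G)) (edges G)) + r + 1 \<le> card (\<Union>(edges G)) + 2 ^ r + 2 ^ s"
    using assms finite_subset by (intro card_indep_sets_le) (auto simp: simple_graph_def)
  thus ?thesis unfolding j_eq[OF G] by (intro mult_left_mono) auto
qed

section \<open>The lexicographic order and the structure of the lex graph\<close>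

lemma lex_less_asym:
  assumes "finite A" "finite B" "lex_less A B"
  shows "\<not> lex_less B A"
proof -
  have "Min ((A - B) \<union> (B - A)) \<in> (A - B) \<union> (B - A)"
    using assms by (intro Min_in) (auto simp: lex_less_def)
  thus ?thesis using assms by (auto simp: lex_less_def Un_commute)
qed

lemma lex_less_pairs:
  assumes "x < y" "u < v" "x < u \<or> x = u \<and> y < v"
  shows "lex_less {x, y} {u, v}"
proof (cases "x < u")
  case True
  have "Min (({x, y} - {u, v}) \<union> ({u, v} - {x, y})) = x"
    using assms True by (intro Min_eqI) auto
  thus ?thesis using assms True by (auto simp: lex_less_def doubleton_eq_iff)
next
  case False
  \<comment> \<open>Equal first entries cancel in the symmetric difference, so its minimum is
    \<open>y\<close>.\<close>
  hence eq: "({x, y} - {u, v}) \<union> ({u, v} - {x, y}) = {y, v}" using assms by auto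
  show ?thesis unfolding lex_less_def eq using assms False by (auto simp: doubleton_eq_iff)
qed

lemma nat_pair_cases:
  assumes "A \<in> [V]\<^bsup>2\<^esup>"
  obtains x y :: nat where "x < y" "A = {x, y}" "x \<in> V" "y \<in> V"
proof -
  obtain a b where "A = {a, b}" "a \<noteq> b" "a \<in> V" "b \<in> V"
    using assms by (auto simp: nsets_def card_2_iff)
  thus ?thesis using that[of a b] that[of b a] by (cases "a < b") (auto simp: insert_commute)
qed

text \<open>In the application \<open>(r choose 2) + s = (q choose 2) - m\<close> with \<open>s < r\<close>: the vertices
  below \<open>q - r\<close> are the dominating ones, and \<open>q - r\<close> is the vertex whose star is cut off.\<close>
definition lex_nonedges :: "nat \<Rightarrow> nat \<Rightarrow> nat \<Rightarrow> nat set set" where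
  "lex_nonedges q r s = [{q - r<..q}]\<^bsup>2\<^esup> \<union> (\<lambda>y. {q - r, y}) ` {q - s<..q}"

lemma lex_nonedges_iff:
  assumes "x < y" "y \<le> q" "s < r" "r < q"
  shows "{x, y} \<in> lex_nonedges q r s \<longleftrightarrow> q - r < x \<or> x = q - r \<and> q - s < y"
  using assms by (auto simp: lex_nonedges_def nsets_def doubleton_eq_iff)

lemma lex_nonedges:
  assumes "s < r" "r < q"
  shows "lex_nonedges q r s \<subseteq> [{1..q}]\<^bsup>2\<^esup>" "card (lex_nonedges q r s) = (r choose 2) + s"
proof -
  show "lex_nonedges q r s \<subseteq> [{1..q}]\<^bsup>2\<^esup>"
    using assms by (auto simp: lex_nonedges_def nsets_def)
  have "card ((\<lambda>y. {q - r, y}) ` {q - s<..q}) = s"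
    using assms by (subst card_image) (auto simp: inj_on_def doubleton_eq_iff)
  moreover have "card ([{q - r<..q}]\<^bsup>2\<^esup>) = r choose 2"
    using assms by (simp add: card_nsets_two)
  moreover have "[{q - r<..q}]\<^bsup>2\<^esup> \<inter> (\<lambda>y. {q - r, y}) ` {q - s<..q} = {}"
    by (auto simp: nsets_def)
  ultimately show "card (lex_nonedges q r s) = (r choose 2) + s"
    unfolding lex_nonedges_def by (subst card_Un_disjoint) (auto simp: finite_nsets_two)
qed

text \<open>The nonedges form a final segment of the order: each of the \<open>m\<close> pairs
  outside \<open>lex_nonedges\<close> precedes each pair inside. Hence the pairs outside are exactly
  the first \<open>m\<close>.\<close>

lemma edges_lex_graph:
  assumes "m + (r choose 2) + s = q choose 2" "s < r" "r < q"
  shows "edges (lex_graph q m) = [{1..q}]\<^bsup>2\<^esup> - lex_nonedges q r s"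
    and "card (edges (lex_graph q m)) = m"
proof -
  let ?P = "[{1..q}]\<^bsup>2\<^esup>" and ?F = "lex_nonedges q r s"
  let ?pre = "\<lambda>A. {B \<in> ?P. lex_less B A}"
  have fin: "finite ?P" by (simp add: finite_nsets_two)
  have cm: "card (?P - ?F) = m"
    using assms lex_nonedges[of s r q] fin finite_subset[of ?F ?P]
    by (simp add: card_Diff_subset card_nsets_two)
  have sep: "lex_less A B" if "A \<in> ?P - ?F" "B \<in> ?F" for A B
  proof -
    have "A \<in> ?P" "B \<in> ?P" using that lex_nonedges(1)[of s r q] assms by auto
    then obtain x y u v where *: "x < y" "A = {x, y}" "y \<le> q" "u < v" "B = {u, v}" "v \<le> q"
      by (elim nat_pair_cases) auto
    show ?thesis using that * assms by (auto simp: lex_nonedges_iff intro!: lex_less_pairs)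
  qed
  have finP: "finite A" if "A \<in> ?P" for A using that by (auto simp: nsets_def)
  have "card (?pre A) < m" if A: "A \<in> ?P - ?F" for A
  proof -
    have "?pre A \<subset> ?P - ?F"
    proof (rule psubsetI)
      show "?pre A \<subseteq> ?P - ?F"
      proof
        fix B assume B: "B \<in> ?pre A"
        hence "finite A" "finite B" "lex_less B A" using A finP by simp_all
        hence "B \<notin> ?F" using sep[OF A] lex_less_asym by blast
        thus "B \<in> ?P - ?F" using B by simp
      qed
      \<comment> \<open>A pair does not precede itself, so a pair outside has strictly fewer than
        \<open>m\<close> predecessors.\<close>
      have "A \<notin> ?pre A" by (simp add: lex_less_def)
      thus "?pre A \<noteq> ?P - ?F" using A by blast
    qed
    thus ?thesis using psubset_card_mono[of "?P - ?F" "?pre A"] fin cm by simp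
  qed
  moreover have "m \<le> card (?pre A)" if "A \<in> ?F" for A
  proof -
    have "?P - ?F \<subseteq> ?pre A" using sep that by blast
    hence "card (?P - ?F) \<le> card (?pre A)" using fin by (intro card_mono) simp_all
    thus ?thesis using cm by simp
  qed
  ultimately have "A \<in> ?P \<Longrightarrow> card (?pre A) < m \<longleftrightarrow> A \<notin> ?F" for A
    by (meson DiffI not_less)
  thus "edges (lex_graph q m) = ?P - ?F" by (auto simp: lex_graph_def)
  thus "card (edges (lex_graph q m)) = m" using cm by simp
qed

text \<open>Three disjoint families are exhibited: singletons of vertices below \<open>q - r\<close>
  (\<open>A\<close>), all subsets of the last \<open>r\<close> vertices (\<open>B\<close>), and
  \<open>q - r\<close> together with any subset of the last \<open>s\<close> vertices
  (\<open>C\<close>). A lower bound suffices, since \<open>j_le\<close> supplies the matching upper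
  one.\<close>

lemma card_indep_sets_lex_graph:
  assumes "m + (r choose 2) + s = q choose 2" "s < r" "r < q"
  shows "q - r - 1 + 2 ^ r + 2 ^ s \<le> card (indep_sets {1..q} (edges (lex_graph q m)))"
proof -
  let ?I = "indep_sets {1..q} (edges (lex_graph q m))"
  define A where "A = (\<lambda>x. {x}) ` {1..<q - r}"
  define B where "B = Pow {q - r<..q}"
  define C where "C = insert (q - r) ` Pow {q - s<..q}"
  note edges = edges_lex_graph(1)[OF assms]
  have "A \<subseteq> ?I"
    using assms by (auto simp: A_def indep_sets_def edges nsets_def subset_singleton_iff)
  moreover have "S \<in> ?I" if S: "S \<in> B \<union> C" for S
  proof -
    have "e \<in> lex_nonedges q r s" if "e \<in> [{1..q}]\<^bsup>2\<^esup>" "e \<subseteq> S" for e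
    proof -
      obtain x y where xy: "x < y" "e = {x, y}" "y \<le> q"
        using \<open>e \<in> [_]\<^bsup>2\<^esup>\<close> by (elim nat_pair_cases) auto
      have "S \<subseteq> {q - r..q}" "q - r \<in> S \<longrightarrow> S \<subseteq> insert (q - r) {q - s<..q}"
        using S assms by (fastforce simp: B_def C_def)+
      hence "q - r \<le> x" "x = q - r \<longrightarrow> q - s < y" using xy \<open>e \<subseteq> S\<close> by auto
      thus ?thesis using xy assms by (auto simp: lex_nonedges_iff)
    qed
    moreover have "S \<subseteq> {1..q}" using S assms by (fastforce simp: B_def C_def)
    ultimately show ?thesis by (auto simp: indep_sets_def edges)
  qed
  ultimately have sub: "A \<union> (B \<union> C) \<subseteq> ?I" by auto
  have "card A = q - r - 1" by (simp add: A_def card_image)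
  moreover have "card B = 2 ^ r" using assms by (simp add: B_def card_Pow)
  moreover have "card C = 2 ^ s"
  proof -
    have "q - r \<notin> S" if "S \<in> Pow {q - s<..q}" for S using that assms by auto
    hence "inj_on (insert (q - r)) (Pow {q - s<..q})"
      by (intro inj_onI) (metis insert_ident)
    thus ?thesis using assms by (simp add: C_def card_image card_Pow)
  qed
  moreover have "B \<inter> C = {}" by (auto simp: B_def C_def)
  moreover have "A \<inter> (B \<union> C) = {}"
    by (auto simp: A_def B_def C_def)
  moreover have "finite A" "finite B" "finite C" by (auto simp: A_def B_def C_def)
  ultimately have "card (A \<union> (B \<union> C)) = q - r - 1 + (2 ^ r + 2 ^ s)"
    by (simp add: card_Un_disjoint)
  moreover have "finite ?I" by (rule finite_subset[of _ "Pow {1..q}"]) (auto simp: indep_sets_def)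
  ultimately show ?thesis using card_mono[OF _ sub] by simp
qed

section \<open>The exact value of \<open>j\<close> on \<open>R_graph\<close>\<close>

lemma exists_triangular_decomposition: "\<exists>r s. (e::nat) = (r choose 2) + s \<and> s < r"
proof (induction e)
  case 0
  show ?case by (intro exI[of _ 1] exI[of _ 0]) (simp add: numeral_2_eq_2)
next
  case (Suc e)
  then obtain r s where rs: "e = (r choose 2) + s" "s < r" by blast
  show ?case
  proof (cases "Suc s < r")
    case True
    thus ?thesis using rs by (intro exI[of _ r] exI[of _ "Suc s"]) simp
  next
    case False
    thus ?thesis using rs by (intro exI[of _ "Suc r"] exI[of _ 0]) (simp add: Suc_choose_two)
  qed
qed

lemma lex_parameters:
  assumes "0 < m" "m \<le> q choose 2"
  obtains r s where "m + (r choose 2) + s = q choose 2" "s < r" "r < q"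
proof -
  obtain r s where rs: "(q choose 2) - m = (r choose 2) + s" "s < r"
    using exists_triangular_decomposition by blast
  \<comment> \<open>As \<open>0 < m\<close>, the number of nonedges is below
    \<open>q choose 2\<close>, which leaves no room for \<open>r \<ge> q\<close>.\<close>
  have "r < q"
  proof (rule ccontr)
    assume "\<not> r < q"
    hence "q choose 2 \<le> r choose 2" by (intro binomial_right_mono) simp
    thus False using rs assms by simp
  qed
  thus ?thesis using that[of r s] rs assms by simp
qed

text \<open>The upper bound \<open>j_le\<close> and the explicit independent sets meet. For this the
  lex part must have no isolated vertex; \<open>q \<le> m + 1\<close> ensures it by making vertex
  \<open>1\<close> adjacent to all others in \<open>{1..q}\<close>.\<close>

lemma R_graph:
  assumes ad: "admissible n q m"
    and p: "m + (r choose 2) + s = q choose 2" "s < r" "r < q" and m: "0 < m"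
  shows "simple_graph (R_graph n q m)" "card (verts (R_graph n q m)) = n"
    "card (edges (R_graph n q m)) = m"
    "j (R_graph n q m) = 3 ^ (n - q) * (q - r - 1 + 2 ^ r + 2 ^ s)"
proof -
  let ?G = "R_graph n q m"
  have qn: "q \<le> n" "q \<le> m + 1" using ad by (auto simp: admissible_def)
  have E: "edges ?G = edges (lex_graph q m)" and V: "verts ?G = {1..n}"
    using qn by (auto simp: R_graph_def graph_union_def edgeless_on_def lex_graph_def)
  show cV: "card (verts ?G) = n" by (simp add: V)
  show cE: "card (edges ?G) = m" using E edges_lex_graph(2)[OF p] by simp
  show simple: "simple_graph ?G"
    unfolding simple_graph_def E V edges_lex_graph(1)[OF p] using qn by (auto simp: nsets_def)
  have "q \<ge> 2" using p by auto
  \<comment> \<open>Here \<open>q - r = 1\<close>, so vertex \<open>1\<close> is the one whose star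
    may be cut off. The edge count gives \<open>m + s = r\<close>, and \<open>q \<le> m + 1\<close>
    means \<open>r \<le> m\<close>, so nothing is cut off.\<close>
  have s0: "s = 0" if "q = Suc r"
    using p(1) qn(2) by (simp add: that Suc_choose_two)
  have star: "{1, y} \<in> edges ?G" if "1 < y" "y \<le> q" for y
  proof -
    have "{1, y} \<notin> lex_nonedges q r s"
      using that p s0 by (subst lex_nonedges_iff) (auto simp: le_Suc_eq)
    thus ?thesis using that by (auto simp: E edges_lex_graph(1)[OF p] nsets_def)
  qed
  have U: "\<Union>(edges ?G) = {1..q}"
  proof
    show "\<Union>(edges ?G) \<subseteq> {1..q}" by (auto simp: E lex_graph_def nsets_def)
    show "{1..q} \<subseteq> \<Union>(edges ?G)"
    proof
      fix y assume "y \<in> {1..q}"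
      thus "y \<in> \<Union>(edges ?G)" using star[of y] star[of 2] \<open>q \<ge> 2\<close> by (cases "y = 1") auto
    qed
  qed
  have "j ?G \<le> 3 ^ (n - q) * (q + 2 ^ r + 2 ^ s - (r + 1))"
    using j_le[OF simple, of r s] p cE by (simp add: U V)
  moreover have "q + 2 ^ r + 2 ^ s - (r + 1) = q - r - 1 + 2 ^ r + 2 ^ s" using p by simp
  moreover have "3 ^ (n - q) * (q - r - 1 + 2 ^ r + 2 ^ s) \<le> j ?G"
    unfolding j_eq[OF simple] U V using card_indep_sets_lex_graph[OF p] by (simp add: E)
  ultimately show "j ?G = 3 ^ (n - q) * (q - r - 1 + 2 ^ r + 2 ^ s)" by simp
qed

section \<open>Existence of an extremal \<open>R_graph\<close>\<close>

lemma j_le_pow3: "simple_graph G \<Longrightarrow> j G \<le> 3 ^ card (verts G)"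
proof -
  assume G: "simple_graph G"
  have fin: "finite (verts G)" using G by (simp add: simple_graph_def)
  have c: "card (verts J_graph) = 3" and finJ: "finite (verts J_graph)" by (simp_all add: J_graph_def)
  have "card (homs G J_graph) \<le> card (verts G \<rightarrow>\<^sub>E verts J_graph)"
    using fin finJ by (intro card_mono finite_PiE) (auto simp: homs_def)
  also have "\<dots> = 3 ^ card (verts G)" using fin by (simp add: card_PiE c)
  finally show ?thesis by (simp add: j_def)
qed

text \<open>Take \<open>q\<close> to be the number of non-isolated vertices of \<open>G\<close>. The
  bound \<open>j_le\<close> for \<open>G\<close> is then exactly the value of \<open>j\<close> on
  \<open>R_graph (m + 1) q m\<close>.\<close>

lemma j_le_j_R_graph:
  fixes G :: "'a graph"
  assumes G: "simple_graph G" and V: "card (verts G) = m + 1" and E: "card (edges G) = m" and m: "0 < m"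
  obtains q where "admissible (m + 1) q m" "j G \<le> j (R_graph (m + 1) q m)"
proof -
  define q where "q = card (\<Union>(edges G))"
  have U: "\<Union>(edges G) \<subseteq> verts G" "edges G \<subseteq> [\<Union>(edges G)]\<^bsup>2\<^esup>" "finite (verts G)"
    using G by (auto simp: simple_graph_def nsets_def)
  hence fin: "finite (\<Union>(edges G))" using finite_subset by blast
  have "q \<le> m + 1" using card_mono[OF U(3,1)] V by (simp add: q_def)
  moreover have mq: "m \<le> q choose 2"
    using card_mono[OF finite_nsets_two[OF fin] U(2)] E by (simp add: card_nsets_two[OF fin] q_def)
  ultimately have ad: "admissible (m + 1) q m" by (simp add: admissible_def)
  obtain r s where p: "m + (r choose 2) + s = q choose 2" "s < r" "r < q"
    using lex_parameters[OF m mq] .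
  have "j G \<le> 3 ^ (m + 1 - q) * (q + 2 ^ r + 2 ^ s - (r + 1))"
    using j_le[OF G, of r s] p E V by (simp add: q_def)
  also have "\<dots> = j (R_graph (m + 1) q m)"
    using R_graph(4)[OF ad p m] p by simp
  finally show ?thesis using that ad by blast
qed

text \<open>Since \<open>j\<close> is bounded by \<open>3 ^ (m + 1)\<close>, some graph maximises
  it; an \<open>R_graph\<close> with at least the same value is itself extremal.\<close>

theorem exists_J_extremal_R_graph:
  assumes m: "0 < m"
  shows "\<exists>q. admissible (m + 1) q m \<and> J_extremal (R_graph (m + 1) q m)"
proof -
  define P where "P = (\<lambda>G :: nat graph. simple_graph G \<and> card (verts G) = m + 1 \<and> card (edges G) = m)"
  have P_R: "P (R_graph (m + 1) q m)" if "admissible (m + 1) q m" for q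
  proof -
    have "m \<le> q choose 2" using that by (simp add: admissible_def)
    then obtain r s where p: "m + (r choose 2) + s = q choose 2" "s < r" "r < q"
      using lex_parameters[OF m] by blast
    show ?thesis unfolding P_def using R_graph[OF that p m] by simp
  qed
  \<comment> \<open>The choice \<open>q = m + 1\<close>, a star with \<open>m\<close> edges, shows
    that there are graphs to maximise over.\<close>
  have "admissible (m + 1) (m + 1) m" by (simp add: admissible_def Suc_choose_two)
  hence "P (R_graph (m + 1) (m + 1) m)" by (rule P_R)
  moreover have "\<forall>G. P G \<longrightarrow> j G \<le> 3 ^ (m + 1)" using j_le_pow3 by (metis P_def)
  ultimately obtain G where G: "P G" "\<And>G'. P G' \<Longrightarrow> j G' \<le> j G"
    using ex_has_greatest_nat[of P _ j "3 ^ (m + 1) + 1"] by (metis less_Suc_eq_le Suc_eq_plus1)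
  then obtain q where q: "admissible (m + 1) q m" "j G \<le> j (R_graph (m + 1) q m)"
    using j_le_j_R_graph[of G m] m by (auto simp: P_def)
  have "J_extremal (R_graph (m + 1) q m)"
    using P_R[OF q(1)] le_trans[OF G(2) q(2)] by (simp add: J_extremal_def P_def)
  thus ?thesis using q by blast
qed

section \<open>Failure of extremality for large \<open>q\<close>, and the bound on
  \<open>ell\<close>\<close>

theorem not_J_extremal_R_graph:
  assumes ad: "admissible (m + 1) q m" and m: "0 < m" and q: "5 \<le> q"
    and large: "6 * int m < (int q - 1) * (int q - 4)"
  shows "\<not> J_extremal (R_graph (m + 1) q m)"
proof
  assume ext: "J_extremal (R_graph (m + 1) q m)"
  have "m \<le> q choose 2" using ad by (simp add: admissible_def)
  then obtain r s where p: "m + (r choose 2) + s = q choose 2" "s < r" "r < q"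
    using lex_parameters[OF m] by blast
  \<comment> \<open>\<open>t\<close> counts the dominating vertices below
    \<open>q - r\<close>.\<close>
  define t where "t = q - r - 1"
  have qt: "q = t + 1 + r" using p by (simp add: t_def)
  \<comment> \<open>Otherwise \<open>3 * r \<le> 2 * q + 2\<close>: there are so few nonedges that
    \<open>m\<close> is too big for \<open>large\<close>. Eliminating \<open>m\<close> and then
    \<open>r\<close> leaves \<open>2 * q * q < 8 * q + 4\<close>, impossible for
    \<open>q \<ge> 5\<close>.\<close>
  have rt: "2 * t + 5 \<le> r"
  proof (rule ccontr)
    assume "\<not> ?thesis"
    hence a: "3 * int r \<le> 2 * int q + 2" using qt by simp
    have "int m + int (r choose 2) + int s = int (q choose 2)" unfolding p(1)[symmetric] by simp
    hence "2 * int m + int r * (int r - 1) + 2 * int s = int q * (int q - 1)"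
      using two_choose_two[of r] two_choose_two[of q] by linarith
    moreover have "int s \<le> int r - 1" using p by simp
    ultimately have "6 * int m \<ge> 3 * (int q * (int q - 1)) - 3 * (int r * (int r - 1)) - 6 * int r + 6"
      by linarith
    hence b: "2 * int q * int q + 2 * int q + 2 < 3 * int r * int r + 3 * int r"
      using large by (simp add: algebra_simps)
    have "(3 * int r) * (3 * int r) \<le> (2 * int q + 2) * (2 * int q + 2)"
      using a by (intro mult_mono) auto
    hence "2 * (int q * int q) < 8 * int q + 4" using a b by (simp add: algebra_simps)
    moreover have "5 * int q \<le> int q * int q" using q by simp
    ultimately show False using q by (simp add: algebra_simps)
  qed
  \<comment> \<open>Passing from \<open>q\<close> to \<open>q - 2\<close> removes
    \<open>2 * q - 3 = 2 * t + 2 * r - 1\<close> pairs, all taken from the nonedges. Lowering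
    \<open>r\<close> by 2 absorbs \<open>2 * r - 3\<close> of them, so \<open>s\<close> must lose
    the other \<open>2 * t + 2\<close>. If \<open>s\<close> is too small for that, \<open>r\<close>
    is lowered by 3 instead.\<close>
  obtain r' s' where p': "m + (r' choose 2) + s' = (q - 2) choose 2" "s' < r'" "r' < q - 2"
    and val: "q - r - 1 + 2 ^ r + 2 ^ s < 9 * (q - 2 - r' - 1 + 2 ^ r' + 2 ^ s')"
  proof (cases "2 * t + 2 \<le> s")
    case True
    then obtain c where c: "s = 2 * t + 2 + c" using le_Suc_ex by blast
    obtain k where k: "r = Suc (Suc k)" using rt le_Suc_ex[of 2 r] by auto
    have q2: "q - 2 = t + 1 + k" "q = Suc (Suc (t + 1 + k))" using qt k by auto
    have "m + (k choose 2) + c = (q - 2) choose 2"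
      using p(1) unfolding q2(1) unfolding q2(2) k c by (simp add: Suc_choose_two)
    \<comment> \<open>The number \<open>t\<close> is unchanged and \<open>2 ^ r = 4 * 2 ^ k\<close>,
      so the two powers sum to less than \<open>8 * 2 ^ k\<close>.\<close>
    moreover have "(2::nat) ^ s < 2 ^ r" using p by (intro power_strict_increasing) auto
    hence "q - r - 1 + 2 ^ r + 2 ^ s < 9 * (q - 2 - k - 1 + 2 ^ k + 2 ^ c)"
      unfolding q2 k by simp
    moreover have "c < k" "k < q - 2" using p c k q2 by auto
    ultimately show ?thesis using that by blast
  next
    case False
    obtain k where k: "r = Suc (Suc (Suc k))" using rt le_Suc_ex[of 3 r] by (auto simp: numeral_3_eq_3)
    \<comment> \<open>The new remainder is nonnegative by \<open>rt\<close>, and it is below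
      \<open>k\<close> because \<open>s < 2 * t + 2\<close>.\<close>
    define c where "c = s + r - (2 * t + 5)"
    have c: "s + k = 2 * t + 2 + c" using rt k by (simp add: c_def)
    have q2: "q - 2 = Suc (t + 1 + k)" "q = Suc (Suc (Suc (t + 1 + k)))" using qt k by auto
    have "m + (k choose 2) + c = (q - 2) choose 2"
      using p(1) c unfolding q2(1) unfolding q2(2) k by (simp add: Suc_choose_two)
    \<comment> \<open>Now \<open>2 ^ r = 8 * 2 ^ k\<close>, and \<open>rt\<close> gives
      \<open>k \<ge> 2 * t + 2 > s\<close>, so the powers sum to at most \<open>9 * 2 ^ k\<close>.
      The strict gain comes from the remaining terms, with \<open>t + 1\<close> in place of
      \<open>t\<close>.\<close>
    moreover have "(2::nat) ^ s \<le> 2 ^ k" using False rt k by (intro power_increasing) auto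
    hence "q - r - 1 + 2 ^ r + 2 ^ s < 9 * (q - 2 - k - 1 + 2 ^ k + 2 ^ c)"
      unfolding q2 k by (simp del: power_increasing_iff)
    moreover have "c < k" "k < q - 2" using False c q2 by auto
    ultimately show ?thesis using that by blast
  qed
  have ad': "admissible (m + 1) (q - 2) m" using ad p' by (auto simp: admissible_def)
  have "3 ^ (m + 1 - (q - 2)) = 3 ^ (m + 1 - q) * (9::nat)"
  proof -
    have "m + 1 - (q - 2) = m + 1 - q + 2" using ad q unfolding admissible_def by linarith
    thus ?thesis by (simp add: power_add)
  qed
  hence "j (R_graph (m + 1) q m) < j (R_graph (m + 1) (q - 2) m)"
    using R_graph(4)[OF ad p m] R_graph(4)[OF ad' p' m] val by simp
  moreover have "j (R_graph (m + 1) (q - 2) m) \<le> j (R_graph (m + 1) q m)"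
    using ext R_graph(1-3)[OF ad p m] R_graph(1-3)[OF ad' p' m] unfolding J_extremal_def by metis
  ultimately show False by simp
qed

theorem theorem4p4:
  fixes m :: nat
  assumes "0 < m"
  shows "real (ell m) \<le> (5 + sqrt (9 + 24 * real m)) / 2"
proof (rule ccontr)
  let ?Q = "{q. admissible (m + 1) q m \<and> J_extremal (R_graph (m + 1) q m)}"
  assume "\<not> ?thesis"
  hence a: "sqrt (9 + 24 * real m) < 2 * real (ell m) - 5" by simp
  have "finite ?Q" by (rule finite_subset[of _ "{..m + 1}"]) (auto simp: admissible_def)
  \<comment> \<open>\<open>Max\<close> is unspecified on the empty set, so the existence of an
    extremal \<open>R_graph\<close> is what gives \<open>ell\<close> its meaning.\<close>
  hence Q: "ell m \<in> ?Q"
    unfolding ell_def using exists_J_extremal_R_graph[OF assms] by (intro Max_in) auto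
  have "5 < sqrt (9 + 24 * real m)" using assms by (intro real_less_rsqrt) simp
  hence "5 \<le> ell m" using a by linarith
  \<comment> \<open>With \<open>q\<close> for \<open>ell m\<close>, the identity
    \<open>(2 * q - 5)^2 = 4 * (q - 1) * (q - 4) + 9\<close> turns the squared inequality into the
    hypothesis \<open>large\<close>.\<close>
  moreover have "9 + 24 * real m < (2 * real (ell m) - 5)\<^sup>2"
    using real_le_rsqrt[of "2 * real (ell m) - 5"] a by (meson not_le)
  hence "6 * real m < (real (ell m) - 1) * (real (ell m) - 4)"
    by (simp add: power2_eq_square algebra_simps)
  hence "real_of_int (6 * int m) < real_of_int ((int (ell m) - 1) * (int (ell m) - 4))" by simp
  hence "6 * int m < (int (ell m) - 1) * (int (ell m) - 4)" by (simp only: of_int_less_iff)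
  ultimately show False using Q not_J_extremal_R_graph assms by blast
qed

end
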